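(* Let $L$ be a complete multiplicative lattice. Suppose $L$ is distributive and $x,y\in L$. If $x$ is compact and $x\leqslant\sqrt{y}$, then $x$ is locally $y$-solvable. Hence, if $L$ is distributive and algebraic, then $\sqrt{y}=\mathrm{loc.solv}(y)$ for all $y\in L$.
   Context: A complete multiplicative lattice is a complete lattice $L$ (smallest element $0$, largest element $1$) equipped with a binary multiplication satisfying $xy\leqslant x\wedge y$ for all $x,y\in L$; nothing else is assumed about the multiplication in general. $L$ is distributive if $x(y\vee z)=xy\vee xz$ and $(x\vee y)z=xz\vee yz$ for all $x,y,z\in L$ (this is not distributivity of the underlying lattice). An element $p\neq 1$ of $L$ is prime if for all $x,y\in L$, $xy\leqslant p$ implies $x\leqslant p$ or $y\leqslant p$. An element of $L$ is radical if it is a meet of a (possibly empty) set of prime elements; $\sqrt{x}$ is the smallest radical element $r$ with $x\leqslant r$. An element $x$ of a complete lattice is compact if every subset $S$ with $x\leqslant\bigvee S$ has a finite subset $F$ with $x\leqslant\bigvee F$; the lattice is algebraic if every element is a join of compact elements. Write $x^2=xx$. $x$ is locally $y$-solvable if, for every infinite sequence $c_0,c_1,c_2,\ldots$ of compact elements of $L$ with $c_0\leqslant x$ and $c_{n+1}\leqslant c_n^2$ for all $n=0,1,2,\ldots$, there exists $n$ with $c_n\leqslant y$; $\mathrm{loc.solv}(y)$ is the join of all locally $y$-solvable elements of $L$. *)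

theory Defs
  imports Main
begin

text \<open>
  The lattice \<open>L\<close> is a type of class \<^class>\<open>complete_lattice\<close> and its multiplication is an
  explicit function on that type; neither associativity, commutativity, monotonicity nor a unit
  is assumed, and the one-element lattice is allowed.
\<close>

locale complete_multiplicative_lattice =
  fixes mult :: "'a::complete_lattice \<Rightarrow> 'a \<Rightarrow> 'a" (infixl "\<cdot>" 70)
  assumes mult_le_inf: "x \<cdot> y \<le> inf x y"

text \<open>Distributivity of the multiplication over binary joins, not of the underlying lattice.\<close>

definition distributive :: "('a::complete_lattice \<Rightarrow> 'a \<Rightarrow> 'a) \<Rightarrow> bool" where
  "distributive mult \<longleftrightarrow>
     (\<forall>x y z. mult x (sup y z) = sup (mult x y) (mult x z) \<and>
              mult (sup x y) z = sup (mult x z) (mult y z))"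

definition prime_element :: "('a::complete_lattice \<Rightarrow> 'a \<Rightarrow> 'a) \<Rightarrow> 'a \<Rightarrow> bool" where
  "prime_element mult p \<longleftrightarrow>
     p \<noteq> top \<and> (\<forall>x y. mult x y \<le> p \<longrightarrow> x \<le> p \<or> y \<le> p)"

text \<open>The set \<open>P\<close> may be empty, so that \<^const>\<open>top\<close> is always radical.\<close>

definition radical_element :: "('a::complete_lattice \<Rightarrow> 'a \<Rightarrow> 'a) \<Rightarrow> 'a \<Rightarrow> bool" where
  "radical_element mult r \<longleftrightarrow> (\<exists>P. (\<forall>p\<in>P. prime_element mult p) \<and> r = Inf P)"

definition radical_of :: "('a::complete_lattice \<Rightarrow> 'a \<Rightarrow> 'a) \<Rightarrow> 'a \<Rightarrow> 'a" where
  "radical_of mult x = (LEAST r. radical_element mult r \<and> x \<le> r)"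

text \<open>The least element in the definition of \<^const>\<open>radical_of\<close> exists.\<close>

lemma radical_of_is_least:
  shows "radical_element mult (radical_of mult x)"
    and "x \<le> radical_of mult x"
    and "radical_element mult r \<Longrightarrow> x \<le> r \<Longrightarrow> radical_of mult x \<le> r"
proof -
  define P where "P = {p. prime_element mult p \<and> x \<le> p}"
  have rad: "radical_element mult (Inf P)"
    unfolding radical_element_def
  proof (intro exI conjI)
    show "\<forall>p\<in>P. prime_element mult p"
      by (simp add: P_def)
    show "Inf P = Inf P"
      by (rule refl)
  qed
  have le: "x \<le> Inf P"
    unfolding P_def by (rule Inf_greatest) blast
  have least: "Inf P \<le> s" if s: "radical_element mult s" "x \<le> s" for s
  proof -
    obtain Q where Q: "\<forall>p\<in>Q. prime_element mult p" "s = Inf Q"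
      using s(1) unfolding radical_element_def by blast
    have "x \<le> p" if "p \<in> Q" for p
      by (rule order_trans [OF s(2)]) (unfold Q(2), rule Inf_lower [OF that])
    then have "Q \<subseteq> P"
      using Q(1) unfolding P_def by blast
    then show ?thesis
      unfolding Q(2) by (rule Inf_superset_mono)
  qed
  have eq: "radical_of mult x = Inf P"
    unfolding radical_of_def
  proof (rule Least_equality)
    show "radical_element mult (Inf P) \<and> x \<le> Inf P"
      using rad le by (rule conjI)
    show "Inf P \<le> s" if "radical_element mult s \<and> x \<le> s" for s
      by (rule least [OF conjunct1 [OF that] conjunct2 [OF that]])
  qed
  show "radical_element mult (radical_of mult x)"
    unfolding eq by (rule rad)
  show "x \<le> radical_of mult x"
    unfolding eq by (rule le)
  show "radical_of mult x \<le> r" if "radical_element mult r" "x \<le> r"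
    unfolding eq by (rule least [OF that])
qed

definition compact_element :: "'a::complete_lattice \<Rightarrow> bool" where
  "compact_element x \<longleftrightarrow>
     (\<forall>S. x \<le> Sup S \<longrightarrow> (\<exists>F. finite F \<and> F \<subseteq> S \<and> x \<le> Sup F))"

text \<open>Algebraicity is a property of the lattice alone, hence the type argument.\<close>

definition algebraic_lattice :: "'a::complete_lattice itself \<Rightarrow> bool" where
  "algebraic_lattice (_ :: 'a itself) \<longleftrightarrow>
     (\<forall>x::'a. \<exists>S. (\<forall>s\<in>S. compact_element s) \<and> x = Sup S)"

text \<open>\<open>locally_solvable mult y x\<close> reads ``\<open>x\<close> is locally \<open>y\<close>-solvable''.\<close>

definition locally_solvable :: "('a::complete_lattice \<Rightarrow> 'a \<Rightarrow> 'a) \<Rightarrow> 'a \<Rightarrow> 'a \<Rightarrow> bool" where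
  "locally_solvable mult y x \<longleftrightarrow>
     (\<forall>c :: nat \<Rightarrow> 'a.
        (\<forall>n. compact_element (c n)) \<and> c 0 \<le> x \<and> (\<forall>n. c (Suc n) \<le> mult (c n) (c n))
        \<longrightarrow> (\<exists>n. c n \<le> y))"

definition loc_solv :: "('a::complete_lattice \<Rightarrow> 'a \<Rightarrow> 'a) \<Rightarrow> 'a \<Rightarrow> 'a" where
  "loc_solv mult y = Sup {x. locally_solvable mult y x}"

end

(* If no term of a descending sequence of compact elements c with c (n+1) below (c n)^2 lies
   below y, then Zorn's lemma, applicable because the c n are compact, gives a maximal z above y
   not above any c n. It is prime: if a and b are not below z, then some c k lies below both
   sup z a and sup z b, so c (k+1) is below the product of these two, which by distributivity is
   below z as soon as the product of a and b is. Hence the radical of y is below z, and c 0 is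
   not below the radical. Conversely, if x is not below a prime p above y, algebraicity
   lets one choose recursively a sequence of compact elements starting below x that
   never gets below p. *)

theory Submission
  imports Defs
begin

lemma (in complete_multiplicative_lattice) mult_le_left: "x \<cdot> y \<le> x"
  and mult_le_right: "x \<cdot> y \<le> y"
  using mult_le_inf[of x y] by simp_all

text \<open>Distributivity supplies the monotonicity that the multiplication is not assumed to have:
  writing the larger factor as a join with the smaller one, one argument at a time, shows the larger
  product as a join containing the smaller.\<close>

lemma distributive_mono:
  assumes "distributive mult" "a \<le> b" "c \<le> d"
  shows "mult a c \<le> mult b d"
proof -
  have "mult b c = sup (mult a c) (mult b c)" "mult b d = sup (mult b c) (mult b d)"
    using assms sup.absorb2 unfolding distributive_def by metis+
  then show ?thesis by (metis sup_ge1 order_trans)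
qed

text \<open>Compactness reduces \<open>C\<close> to a finite subset, and in a nonempty chain a
  finite subset is bounded by a single member: the induction keeps the larger of the old bound and
  the new element.\<close>

lemma compact_le_Sup_chain:
  fixes C :: "'a::complete_lattice set"
  assumes "compact_element x" "x \<le> Sup C" "C \<noteq> {}"
    and chain: "\<And>a b. a \<in> C \<Longrightarrow> b \<in> C \<Longrightarrow> a \<le> b \<or> b \<le> a"
  shows "\<exists>a\<in>C. x \<le> a"
proof -
  obtain F where F: "finite F" "F \<subseteq> C" "x \<le> Sup F"
    using assms(1,2) unfolding compact_element_def by blast
  have "\<exists>a\<in>C. Sup F \<le> a"
    using F(1,2)
  proof (induction rule: finite_induct)
    case empty
    then show ?case using \<open>C \<noteq> {}\<close> by auto
  next
    case (insert b F)
    then obtain a where "a \<in> C" "Sup F \<le> a" by auto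
    with chain[of a b] insert.prems show ?case
      by (metis Sup_insert insert_subset le_sup_iff order_refl order_trans)
  qed
  with F(3) show ?thesis by (meson order_trans)
qed

lemma ex_maximal_avoiding_compacts:
  fixes y :: "'a::complete_lattice"
  assumes "\<And>c. c \<in> K \<Longrightarrow> compact_element c" and "\<And>c. c \<in> K \<Longrightarrow> \<not> c \<le> y"
  obtains z where "y \<le> z" "\<And>c. c \<in> K \<Longrightarrow> \<not> c \<le> z"
    and "\<And>w. z < w \<Longrightarrow> \<exists>c\<in>K. c \<le> w"
proof -
  define A where "A = {z. y \<le> z \<and> (\<forall>c\<in>K. \<not> c \<le> z)}"
  have "y \<in> A" using assms(2) by (simp add: A_def)
  have "\<exists>m\<in>A. \<forall>a\<in>A. m \<le> a \<longrightarrow> a = m"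
  proof (rule predicate_Zorn)
    show "partial_order_on A (relation_of (\<le>) A)"
      by (rule partial_order_on_relation_ofI) auto
  next
    fix C assume "C \<in> Chains (relation_of (\<le>) A)"
    then have chain: "a \<le> b \<or> b \<le> a" and "a \<in> A" if "a \<in> C" "b \<in> C" for a b
      using that unfolding Chains_def relation_of_def by auto
    then have "C \<subseteq> A" by auto
    show "\<exists>u\<in>A. \<forall>a\<in>C. a \<le> u"
    \<comment> \<open>The empty chain needs \<open>y\<close> as its upper bound, because its join
      \<open>bot\<close> need not lie above \<open>y\<close>.\<close>
    proof (cases "C = {}")
      case True
      then show ?thesis using \<open>y \<in> A\<close> by auto
    next
      case False
      then have "y \<le> Sup C"
        using \<open>C \<subseteq> A\<close> unfolding A_def by (blast intro: Sup_upper2)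
      moreover have "\<not> c \<le> Sup C" if "c \<in> K" for c
        using compact_le_Sup_chain[OF assms(1)[OF that] _ False chain] that \<open>C \<subseteq> A\<close>
        unfolding A_def by blast
      ultimately have "Sup C \<in> A" by (simp add: A_def)
      then show ?thesis by (blast intro: Sup_upper)
    qed
  qed
  then obtain z where z: "z \<in> A" and max: "\<And>a. a \<in> A \<Longrightarrow> z \<le> a \<Longrightarrow> a = z"
    by blast
  show thesis
  proof
    show "y \<le> z" using z by (simp add: A_def)
    show "\<not> c \<le> z" if "c \<in> K" for c
      using z that by (simp add: A_def)
    show "\<exists>c\<in>K. c \<le> w" if "z < w" for w
      using max[of w] that z by (force simp: A_def)
  qed
qed

lemma radical_of_le_prime:
  assumes "prime_element mult p" "y \<le> p"
  shows "radical_of mult y \<le> p"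
  using assms by (intro radical_of_is_least(3)) (auto simp: radical_element_def intro!: exI[of _ "{p}"])

text \<open>The radical is the meet of some set of primes, and each of these lies above
  \<open>y\<close> because the radical does.\<close>

lemma le_radical_ofI:
  assumes "\<And>p. prime_element mult p \<Longrightarrow> y \<le> p \<Longrightarrow> x \<le> p"
  shows "x \<le> radical_of mult y"
proof -
  obtain P where P: "\<forall>p\<in>P. prime_element mult p" "radical_of mult y = Inf P"
    using radical_of_is_least(1) unfolding radical_element_def by blast
  have "y \<le> Inf P" using radical_of_is_least(2) P(2) by metis
  then show ?thesis
    unfolding P(2) using P(1) assms by (auto intro!: Inf_greatest simp: le_Inf_iff)
qed

lemma locally_solvable_if_le_radical:
  assumes "complete_multiplicative_lattice mult" and dist: "distributive mult"
    and "x \<le> radical_of mult y"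
  shows "locally_solvable mult y x"
  unfolding locally_solvable_def
proof (intro allI impI, rule ccontr)
  interpret complete_multiplicative_lattice mult by fact
  fix c :: "nat \<Rightarrow> 'a"
  assume "(\<forall>n. compact_element (c n)) \<and> c 0 \<le> x \<and> (\<forall>n. c (Suc n) \<le> mult (c n) (c n))"
    and not_le: "\<nexists>n. c n \<le> y"
  then have compact: "\<And>n. compact_element (c n)" and c0: "c 0 \<le> x"
    and step: "\<And>n. c (Suc n) \<le> mult (c n) (c n)"
    by simp_all
  obtain z where "y \<le> z" and "\<And>d. d \<in> range c \<Longrightarrow> \<not> d \<le> z"
    and max: "\<And>w. z < w \<Longrightarrow> \<exists>d\<in>range c. d \<le> w"
  proof (rule ex_maximal_avoiding_compacts[of "range c" y])
    show "compact_element d" "\<not> d \<le> y" if "d \<in> range c" for d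
      using that compact not_le by auto
  qed (rule that)
  then have avoid: "\<not> c n \<le> z" for n
    by blast
  have "c (Suc n) \<le> c n" for n
    by (rule order_trans[OF step mult_le_left])
  then have dec: "c m \<le> c n" if "n \<le> m" for m n
    using that by (rule lift_Suc_antimono_le)
  have "prime_element mult z"
    unfolding prime_element_def
  proof (intro conjI allI impI)
    show "z \<noteq> top" using avoid by auto
  next
    fix a b assume ab: "mult a b \<le> z"
    show "a \<le> z \<or> b \<le> z"
    proof (rule ccontr)
      assume "\<not> (a \<le> z \<or> b \<le> z)"
      then have "z < sup z a" "z < sup z b"
        by (simp_all add: less_le_not_le)
      then obtain m n where "c m \<le> sup z a" "c n \<le> sup z b"
        using max by blast
      \<comment> \<open>The sequence decreases, so the term with the later index lies below both
        joins.\<close>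
      then have "c (max m n) \<le> sup z a" "c (max m n) \<le> sup z b"
        by (meson dec max.cobounded1 max.cobounded2 order_trans)+
      then have "mult (c (max m n)) (c (max m n)) \<le> mult (sup z a) (sup z b)"
        by (rule distributive_mono[OF dist])
      also have "\<dots> = sup (sup (mult z z) (mult a z)) (sup (mult z b) (mult a b))"
        using dist unfolding distributive_def by simp
      \<comment> \<open>Three of the four products have \<open>z\<close> as a factor and so lie
        below it; the fourth is \<open>mult a b\<close>.\<close>
      also have "\<dots> \<le> z"
        using ab by (simp add: mult_le_left mult_le_right)
      finally have "c (Suc (max m n)) \<le> z"
        by (rule order_trans[OF step])
      then show False
        using avoid by blast
    qed
  qed
  then have "radical_of mult y \<le> z" using \<open>y \<le> z\<close> by (rule radical_of_le_prime)
  then have "c 0 \<le> z" using c0 assms(3) by (meson order_trans)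
  with avoid show False by blast
qed

lemma algebraic_not_leD:
  fixes x p :: "'a::complete_lattice"
  assumes "algebraic_lattice TYPE('a)" "\<not> x \<le> p"
  shows "\<exists>c. compact_element c \<and> c \<le> x \<and> \<not> c \<le> p"
proof -
  obtain S where S: "\<forall>s\<in>S. compact_element s" "x = Sup S"
    using assms(1) unfolding algebraic_lattice_def by blast
  with assms(2) show ?thesis
    by (metis Sup_least Sup_upper)
qed

lemma locally_solvable_le_radical:
  fixes mult :: "'a::complete_lattice \<Rightarrow> 'a \<Rightarrow> 'a"
  assumes alg: "algebraic_lattice TYPE('a)" and x: "locally_solvable mult y x"
  shows "x \<le> radical_of mult y"
proof (rule le_radical_ofI, rule ccontr)
  fix p assume p: "prime_element mult p" "y \<le> p" and "\<not> x \<le> p"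
  then obtain c0 where c0: "compact_element c0" "c0 \<le> x" "\<not> c0 \<le> p"
    using algebraic_not_leD[OF alg] by blast
  \<comment> \<open>The index \<open>n\<close> serves only to impose the starting condition
    \<open>c 0 \<le> x\<close> within the invariant of a dependent choice.\<close>
  define good where "good n c \<longleftrightarrow> compact_element c \<and> \<not> c \<le> p \<and> (n = 0 \<longrightarrow> c \<le> x)"
    for n :: nat and c
  have "\<exists>c. good 0 c"
    using c0 unfolding good_def by blast
  moreover have "\<exists>d. good (Suc n) d \<and> d \<le> mult c c" if "good n c" for n c
  proof -
    \<comment> \<open>Primeness with both factors equal to \<open>c\<close> keeps the square off
      \<open>p\<close>, so algebraicity finds the next compact term below the square.\<close>
    have "\<not> mult c c \<le> p"
      using p(1) that unfolding prime_element_def good_def by blast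
    then show ?thesis
      using algebraic_not_leD[OF alg] unfolding good_def by blast
  qed
  ultimately obtain c where c: "\<And>n. good n (c n)" "\<And>n. c (Suc n) \<le> mult (c n) (c n)"
    using dependent_nat_choice[of good "\<lambda>n c d. d \<le> mult c c"] by blast
  then have "\<exists>n. c n \<le> y"
    using x unfolding locally_solvable_def good_def by blast
  then show False
    using c(1) p(2) unfolding good_def by (meson order_trans)
qed

theorem theorem6p17:
  fixes mult :: "'a::complete_lattice \<Rightarrow> 'a \<Rightarrow> 'a"
  assumes "complete_multiplicative_lattice mult"
    and "distributive mult"
  shows "(\<forall>x y. compact_element x \<and> x \<le> radical_of mult y \<longrightarrow> locally_solvable mult y x) \<and>
         (algebraic_lattice TYPE('a) \<longrightarrow> (\<forall>y. radical_of mult y = loc_solv mult y))"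
proof (intro conjI allI impI)
  show "locally_solvable mult y x" if "compact_element x \<and> x \<le> radical_of mult y" for x y
    using that by (intro locally_solvable_if_le_radical[OF assms]) simp
  \<comment> \<open>By \<open>order_refl\<close> the radical is itself locally solvable, and all
    locally solvable elements lie below it, so it is the greatest of them and hence their
    join.\<close>
  show "radical_of mult y = loc_solv mult y" if "algebraic_lattice TYPE('a)" for y
    unfolding loc_solv_def
    using locally_solvable_if_le_radical[OF assms order_refl] locally_solvable_le_radical[OF that]
    by (auto intro!: antisym Sup_least Sup_upper)
qed

end
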